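(* There exists no continuous map of transformations between $\operatorname{Tjur}(M^t_{m,n})$ and $\operatorname{Tjur}^T(M^t_{m,n})$, in either direction: there is no continuous map of transformations from $\operatorname{Tjur}(M^t_{m,n})$ to $\operatorname{Tjur}^T(M^t_{m,n})$, and there is none from $\operatorname{Tjur}^T(M^t_{m,n})$ to $\operatorname{Tjur}(M^t_{m,n})$.
   Context: $M_{m,n}$ is the set of $m\times n$ complex matrices, and $M^t_{m,n}\subset M_{m,n}$ (the model determinantal singularity of type $(m,n,t)$) is the subset of matrices of rank $<t$. $\operatorname{Gr}(k,r)$ is the Grassmannian of $k$-dimensional linear subspaces of $\mathbb{C}^r$. Regarding $A\in M_{m,n}$ as a linear map $A\colon\mathbb{C}^n\to\mathbb{C}^m$, the Tjurina transform and the transpose Tjurina transform of $M^t_{m,n}$ are $$\operatorname{Tjur}(M^t_{m,n})=\{(A,W)\in M_{m,n}\times \operatorname{Gr}(n-t+1,n) \mid A(W)=0\},$$ $$\operatorname{Tjur}^T(M^t_{m,n})=\{(A,W)\in M_{m,n}\times \operatorname{Gr}(m-t+1,m) \mid A^T(W)=0\}.$$ In both cases the map to $M^t_{m,n}$ is the projection to the first factor, and both are regarded as transformations of the pair $(M^t_{m,n},M^{t-1}_{m,n})$. Here a transformation of $(X,A)$, with $A\subset X$ a closed subvariety of a variety $X$, is a variety $\widetilde X$ with a proper map $\pi\colon\widetilde X\to X$ such that $\pi\colon\pi^{-1}(X-A)\to X-A$ is an isomorphism and $\overline{\pi^{-1}(X-A)}=\widetilde X$. A map $f\colon T_1\to T_2$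 between two transformations $\pi_i\colon T_i\to X$ of the same space and subspace is called a map of transformations if $\pi_1=\pi_2\circ f$.
   Formalization: The range 2 ≤ t ≤ min(m,n) is added: for t = 1 both transforms are single points, so maps exist, and for t = n+1 ≤ m the projection Tjur^T → M_{m,n} = Tjur is a continuous map of transformations (symmetrically for t = m+1 ≤ n). *)

theory Defs
  imports "HOL-Analysis.Analysis"
begin

definition grassmannian :: "nat \<Rightarrow> (complex^'r) set set" where
  "grassmannian k = {W. vec.subspace W \<and> vec.dim W = k}"

definition frames :: "nat \<Rightarrow> (nat \<Rightarrow> complex^'r) set" where
  "frames k = {v \<in> extensional {..<k}. inj_on v {..<k} \<and> vec.independent (v ` {..<k})}"

definition frame_topology :: "nat \<Rightarrow> (nat \<Rightarrow> complex^'r) topology" where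
  "frame_topology k = subtopology (product_topology (\<lambda>_. euclidean) {..<k}) (frames k)"

abbreviation frame_span :: "nat \<Rightarrow> (nat \<Rightarrow> complex^'r) \<Rightarrow> (complex^'r) set" where
  "frame_span k v \<equiv> vec.span (v ` {..<k})"

text \<open>The classical topology of the Grassmannian: the quotient of the space of \<open>k\<close>-frames
  by the map sending a frame to its span (see \<open>quotient_map_frame_span\<close>).\<close>

definition grassmannian_topology :: "nat \<Rightarrow> (complex^'r) set topology" where
  "grassmannian_topology k = topology (\<lambda>U. U \<subseteq> grassmannian k \<and>
     openin (frame_topology k) {v \<in> frames k. frame_span k v \<in> U})"

lemma topspace_frame_topology: "topspace (frame_topology k) = frames k"
  by (auto simp: frame_topology_def frames_def PiE_def)

lemma openin_grassmannian_topology: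
  fixes U :: "(complex^'r) set set"
  shows "openin (grassmannian_topology k) U \<longleftrightarrow> U \<subseteq> grassmannian k \<and>
     openin (frame_topology k) {v \<in> frames k. frame_span k v \<in> U}"
proof -
  have "istopology (\<lambda>U :: (complex^'r) set set. U \<subseteq> grassmannian k \<and>
     openin (frame_topology k) {v \<in> frames k. frame_span k v \<in> U})"
  proof (unfold istopology_def, intro conjI allI impI)
    fix S T :: "(complex^'r) set set"
    assume S: "S \<subseteq> grassmannian k \<and> openin (frame_topology k) {v \<in> frames k. frame_span k v \<in> S}"
      and T: "T \<subseteq> grassmannian k \<and> openin (frame_topology k) {v \<in> frames k. frame_span k v \<in> T}"
    show "S \<inter> T \<subseteq> grassmannian k" using S by blast
    have "{v \<in> frames k. frame_span k v \<in> S \<inter> T} =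
        {v \<in> frames k. frame_span k v \<in> S} \<inter> {v \<in> frames k. frame_span k v \<in> T}" by blast
    then show "openin (frame_topology k) {v \<in> frames k. frame_span k v \<in> S \<inter> T}"
      using S T by (simp add: openin_Int)
  next
    fix \<K> :: "(complex^'r) set set set"
    assume K: "\<forall>K\<in>\<K>. K \<subseteq> grassmannian k \<and> openin (frame_topology k) {v \<in> frames k. frame_span k v \<in> K}"
    then show "\<Union>\<K> \<subseteq> grassmannian k" by blast
    have "{v \<in> frames k. frame_span k v \<in> \<Union>\<K>} =
        (\<Union>K\<in>\<K>. {v \<in> frames k. frame_span k v \<in> K})" by blast
    then show "openin (frame_topology k) {v \<in> frames k. frame_span k v \<in> \<Union>\<K>}"
      using K by auto
  qed
  then show ?thesis
    unfolding grassmannian_topology_def by (simp only: topology_inverse')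
qed

lemma frame_span_in_grassmannian:
  assumes "v \<in> frames k" shows "frame_span k v \<in> grassmannian k"
  using assms by (simp add: frames_def grassmannian_def vec.dim_eq_card_independent card_image)

lemma topspace_grassmannian_topology:
  "topspace (grassmannian_topology k) = (grassmannian k :: (complex^'r) set set)"
proof
  show "topspace (grassmannian_topology k) \<subseteq> (grassmannian k :: (complex^'r) set set)"
    using openin_grassmannian_topology[of k] openin_topspace by blast
  have "{v \<in> frames k. frame_span k v \<in> (grassmannian k :: (complex^'r) set set)} = topspace (frame_topology k)"
    using frame_span_in_grassmannian by (auto simp: topspace_frame_topology)
  then show "(grassmannian k :: (complex^'r) set set) \<subseteq> topspace (grassmannian_topology k)"
    by (intro openin_subset) (simp only: openin_grassmannian_topology openin_topspace subset_refl simp_thms)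
qed

lemma quotient_map_frame_span:
  "quotient_map (frame_topology k)
     (grassmannian_topology k :: (complex^'r) set topology) (frame_span k)"
proof -
  have "W \<in> frame_span k ` frames k" if W: "W \<in> grassmannian k" for W :: "(complex^'r) set"
  proof -
    obtain B where B: "B \<subseteq> W" "vec.independent B" "W \<subseteq> vec.span B" "card B = vec.dim W"
      using vec.basis_exists by blast
    have "vec.span B = W"
      using B W by (auto simp: grassmannian_def intro: vec.span_minimal[THEN subsetD])
    moreover obtain h where h: "bij_betw h {..<k} B"
      using ex_bij_betw_nat_finite[OF vec.finiteI_independent[OF B(2)]] B(4) W
      by (auto simp: grassmannian_def atLeast0LessThan)
    define v where "v = restrict h {..<k}"
    have "v ` {..<k} = B" "inj_on v {..<k}" "v \<in> extensional {..<k}"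
      using h by (auto simp: v_def bij_betw_def inj_on_def)
    ultimately show ?thesis
      using B by (intro image_eqI[of _ _ v]) (auto simp: frames_def)
  qed
  then show ?thesis
    unfolding quotient_map_def topspace_frame_topology topspace_grassmannian_topology
    using frame_span_in_grassmannian by (auto simp: openin_grassmannian_topology)
qed

text \<open>The transforms are spaces over the space of matrices via \<^const>\<open>fst\<close>. Points \<open>(A, W)\<close>
  automatically have \<open>rank A < t\<close>, so \<^const>\<open>fst\<close> takes values in the model singularity.
  The difference is on natural numbers, so these definitions are meant for
  \<open>t \<le> CARD('n)\<close> and \<open>t \<le> CARD('m)\<close> respectively.\<close>

definition Tjur :: "nat \<Rightarrow> ((complex^'n^'m) \<times> (complex^'n) set) topology" where
  "Tjur t = subtopology (prod_topology euclidean (grassmannian_topology (CARD('n) - t + 1)))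
     {(A, W). \<forall>w\<in>W. A *v w = 0}"

definition Tjur_transpose :: "nat \<Rightarrow> ((complex^'n^'m) \<times> (complex^'m) set) topology" where
  "Tjur_transpose t = subtopology (prod_topology euclidean (grassmannian_topology (CARD('m) - t + 1)))
     {(A, W). \<forall>w\<in>W. transpose A *v w = 0}"

lemma topspace_Tjur:
  "topspace (Tjur t :: ((complex^'n^'m) \<times> (complex^'n) set) topology) =
     {(A, W). W \<in> grassmannian (CARD('n) - t + 1) \<and> (\<forall>w\<in>W. A *v w = 0)}"
  by (auto simp: Tjur_def topspace_grassmannian_topology)

lemma topspace_Tjur_transpose:
  "topspace (Tjur_transpose t :: ((complex^'n^'m) \<times> (complex^'m) set) topology) =
     {(A, W). W \<in> grassmannian (CARD('m) - t + 1) \<and> (\<forall>w\<in>W. transpose A *v w = 0)}"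
  by (auto simp: Tjur_transpose_def topspace_grassmannian_topology)

definition continuous_map_of_transformations ::
  "'a topology \<Rightarrow> ('a \<Rightarrow> 'x) \<Rightarrow> 'b topology \<Rightarrow> ('b \<Rightarrow> 'x) \<Rightarrow> ('a \<Rightarrow> 'b) \<Rightarrow> bool" where
  "continuous_map_of_transformations T1 \<pi>1 T2 \<pi>2 f \<longleftrightarrow>
     continuous_map T1 T2 f \<and> (\<forall>p\<in>topspace T1. \<pi>1 p = \<pi>2 (f p))"

end

theory Submission
  imports Defs
begin

text \<open>
  A map of transformations sends \<open>(A, W)\<close> to some \<open>(A, V)\<close> with \<open>V\<close> contained in
  \<open>ker A\<^sup>T\<close>.  If \<open>A\<close> has rank \<open>t - 1\<close>, then \<open>ker A\<^sup>T\<close> has the dimension required of \<open>V\<close>, so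
  \<open>V = ker A\<^sup>T\<close>.  Fix \<open>W\<close> and a matrix \<open>B\<close> of rank \<open>t - 1\<close> killing \<open>W\<close>, and
  approach \<open>(0, W)\<close> along the line \<open>(s B, W)\<close>.  For \<open>s \<noteq> 0\<close> the second component of the image is
  the constant \<open>ker B\<^sup>T\<close>, so by continuity, and because points of the Grassmannian are closed, the
  image of \<open>(0, W)\<close> is \<open>(0, ker B\<^sup>T)\<close>
  (\<open>image_of_zero_matrix\<close>).  But \<open>ker B\<^sup>T\<close> is determined by the image of \<open>B\<close>, and matrices with the
  same kernel \<open>W\<close> can have different images as soon as \<open>0 < t - 1 < m\<close>.  So the value at
  \<open>(0, W)\<close> would have to be two different subspaces at once.

  Coordinate subspaces and partial permutation matrices suffice for \<open>W\<close> and \<open>B\<close>.  The other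
  direction is the same statement for the transposed matrix space, because \<open>A \<mapsto> A\<^sup>T\<close> exchanges
  the two kinds of transform.
\<close>

definition coordinate_subspace :: "'r set \<Rightarrow> (complex^'r) set" where
  "coordinate_subspace d = {x. \<forall>i. i \<notin> d \<longrightarrow> x $ i = 0}"

lemma subspace_coordinate_subspace: "vec.subspace (coordinate_subspace d)"
  by (auto simp: coordinate_subspace_def vec.subspace_def)

lemma dim_coordinate_subspace: "vec.dim (coordinate_subspace d) = card d"
  unfolding coordinate_subspace_def by (rule dim_substandard_cart)

lemma inj_coordinate_subspace:
  assumes "coordinate_subspace d = coordinate_subspace e"
  shows "d = e"
proof -
  have "i \<in> d \<longleftrightarrow> axis i 1 \<in> coordinate_subspace d" for i and d :: "'a set"
    by (auto simp: coordinate_subspace_def axis_def)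
  then show ?thesis using assms by blast
qed

lemma complement_coordinate_subspace_in_grassmannian:
  fixes S :: "'r::finite set"
  assumes "card S = t - 1" "1 \<le> t" "t \<le> CARD('r)"
  shows "coordinate_subspace (- S) \<in> grassmannian (CARD('r) - t + 1)"
  using assms
  by (simp add: grassmannian_def subspace_coordinate_subspace dim_coordinate_subspace
      Compl_eq_Diff_UNIV card_Diff_subset)

lemma closed_vec_subspace:
  fixes V :: "(complex^'r) set"
  assumes "vec.subspace V"
  shows "closed V"
proof (rule closed_subspace)
  have "c *\<^sub>R x = complex_of_real c *s x" for c and x :: "complex^'r"
    unfolding vec_eq_iff vector_scaleR_component vector_smult_component
    by (simp add: scaleR_conv_of_real)
  then show "subspace V"
    using assms by (auto simp: vec.subspace_def intro!: subspaceI)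
qed

text \<open>A \<open>k\<close>-frame spans the \<open>k\<close>-dimensional space \<open>V\<close> exactly if all its members lie in \<open>V\<close>,
  which is a closed condition on frames.\<close>

lemma closedin_grassmannian_singleton:
  fixes V :: "(complex^'r) set"
  assumes V: "V \<in> grassmannian k"
  shows "closedin (grassmannian_topology k) {V}"
proof -
  have sub: "vec.subspace V" and dim: "vec.dim V = k"
    using V by (auto simp: grassmannian_def)
  have span_iff: "frame_span k v = V \<longleftrightarrow> (\<forall>i<k. v i \<in> V)" if "v \<in> frames k" for v
  proof
    show "frame_span k v = V \<Longrightarrow> \<forall>i<k. v i \<in> V"
      by (auto intro: vec.span_base)
    assume "\<forall>i<k. v i \<in> V"
    then have "frame_span k v \<subseteq> V"
      using sub by (intro vec.span_minimal) auto
    then show "frame_span k v = V"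
      using frame_span_in_grassmannian[OF that] sub dim
      by (intro vec.subspace_dim_equal) (auto simp: grassmannian_def)
  qed
  have "openin (frame_topology k) {v \<in> topspace (frame_topology k). v i \<in> - V}" if "i < k" for i
  proof (rule openin_continuous_map_preimage)
    show "continuous_map (frame_topology k) euclidean (\<lambda>v. v i)"
      unfolding frame_topology_def using that
      by (intro continuous_map_from_subtopology continuous_map_product_projection) auto
    show "openin euclidean (- V)"
      using closed_vec_subspace[OF sub] by (simp add: open_Compl)
  qed
  then have "openin (frame_topology k)
      (\<Union>i<k. {v \<in> topspace (frame_topology k). v i \<in> - V})"
    by (intro openin_Union) auto
  moreover have "(\<Union>i<k. {v \<in> topspace (frame_topology k). v i \<in> - V}) =
      {v \<in> frames k. frame_span k v \<in> grassmannian k - {V}}"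
    using span_iff frame_span_in_grassmannian by (auto simp: topspace_frame_topology)
  ultimately show ?thesis
    using V by (simp add: closedin_def topspace_grassmannian_topology openin_grassmannian_topology)
qed

text \<open>The line \<open>(s B, W)\<close> described above, for the partial permutation matrix \<open>B\<close> of a bijection
  from \<open>S\<close> to \<open>R\<close>: its kernel is the coordinate subspace off \<open>S\<close>, that of its transpose the
  coordinate subspace off \<open>R\<close>.  Only \<open>S\<close> is visible at \<open>s = 0\<close>, yet the value
  there is forced to be the subspace given by \<open>R\<close>.\<close>

lemma image_of_zero_matrix:
  fixes S :: "'n::finite set" and R :: "'m::finite set"
  assumes f: "continuous_map_of_transformations
      (Tjur t :: ((complex^'n^'m) \<times> (complex^'n) set) topology) fst
      (Tjur_transpose t :: ((complex^'n^'m) \<times> (complex^'m) set) topology) fst f"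
    and t: "1 \<le> t" "t \<le> CARD('m)" "t \<le> CARD('n)"
    and S: "card S = t - 1" and R: "card R = t - 1"
  shows "snd (f (0, coordinate_subspace (- S))) = coordinate_subspace (- R)"
proof -
  define W V where "W = coordinate_subspace (- S)" and "V = coordinate_subspace (- R)"
  have W: "W \<in> grassmannian (CARD('n) - t + 1)" and V: "V \<in> grassmannian (CARD('m) - t + 1)"
    using complement_coordinate_subspace_in_grassmannian S R t by (auto simp: W_def V_def)
  obtain \<sigma> where \<sigma>: "bij_betw \<sigma> S R"
    using finite_same_card_bij[OF finite finite, of S R] S R by metis
  define B :: "complex^'n^'m" where "B = (\<chi> i j. if j \<in> S \<and> i = \<sigma> j then 1 else 0)"
  have B: "B *v w = 0" if "w \<in> W" for w
    using that
    by (auto simp: B_def W_def coordinate_subspace_def matrix_vector_mult_def vec_eq_iff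
        intro!: sum.neutral)
  have B_transpose: "y \<in> V" if "transpose B *v y = 0" for y
  proof -
    have "y $ \<sigma> j = 0" if "j \<in> S" for j
    proof -
      have "(transpose B *v y) $ j = y $ \<sigma> j"
        using that
        by (simp add: B_def matrix_vector_mult_def transpose_def if_distrib[of "\<lambda>c. c * _"]
            cong: if_cong)
      then show ?thesis using \<open>transpose B *v y = 0\<close> by simp
    qed
    then show ?thesis
      using \<sigma> by (auto simp: V_def coordinate_subspace_def bij_betw_def)
  qed
  define line where "line = (\<lambda>s::real. (s *\<^sub>R B, W))"
  have scale: "(s *\<^sub>R A) *v x = s *\<^sub>R (A *v x)" for s x and A :: "complex^'a^'b"
    by (simp add: matrix_vector_mult_def vec_eq_iff scaleR_sum_right)
  have line: "continuous_map euclideanreal (Tjur t) line"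
    unfolding Tjur_def continuous_map_in_subtopology
  proof
    have "continuous_map euclideanreal euclidean (\<lambda>s. s *\<^sub>R B)"
      by (auto intro: continuous_intros)
    then show "continuous_map euclideanreal
        (prod_topology euclidean (grassmannian_topology (CARD('n) - t + 1))) line"
      unfolding line_def using W
      by (intro continuous_map_pairedI) (auto simp: topspace_grassmannian_topology)
  qed (auto simp: line_def scale B)
  have f_cont: "continuous_map (Tjur t) (Tjur_transpose t) f"
    and f_fst: "\<And>p. p \<in> topspace (Tjur t) \<Longrightarrow> fst (f p) = fst p"
    using f by (auto simp: continuous_map_of_transformations_def)
  have line_top: "line s \<in> topspace (Tjur t)" for s
    using line by (auto simp: continuous_map_def)
  have "continuous_map (Tjur_transpose t :: ((complex^'n^'m) \<times> (complex^'m) set) topology)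
      (grassmannian_topology (CARD('m) - t + 1)) snd"
    unfolding Tjur_transpose_def by (intro continuous_map_from_subtopology continuous_map_snd)
  then have "continuous_map euclideanreal (grassmannian_topology (CARD('m) - t + 1))
      (snd \<circ> (f \<circ> line))"
    using line f_cont by (blast intro: continuous_map_compose)
  from closedin_continuous_map_preimage[OF this closedin_grassmannian_singleton[OF V]]
  have closed: "closed {s. snd (f (line s)) = V}"
    by simp
  have off_zero: "snd (f (line s)) = V" if "s \<noteq> 0" for s
  proof (rule vec.subspace_dim_equal)
    have "f (line s) \<in> topspace (Tjur_transpose t)"
      using f_cont line_top[of s] by (auto simp: continuous_map_def)
    moreover have "fst (f (line s)) = s *\<^sub>R B"
      using f_fst[OF line_top] by (simp add: line_def)
    ultimately have U: "snd (f (line s)) \<in> grassmannian (CARD('m) - t + 1)"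
      "\<forall>y\<in>snd (f (line s)). transpose (s *\<^sub>R B) *v y = 0"
      by (auto simp: topspace_Tjur_transpose split_beta)
    show "vec.subspace (snd (f (line s)))" "vec.subspace V"
      "vec.dim V \<le> vec.dim (snd (f (line s)))"
      using U(1) V by (auto simp: grassmannian_def)
    have "transpose (s *\<^sub>R B) = s *\<^sub>R transpose B"
      by (simp add: transpose_def vec_eq_iff)
    then show "snd (f (line s)) \<subseteq> V"
      using U(2) that B_transpose by (auto simp: scale)
  qed
  have "closure (- {0::real}) \<subseteq> {s. snd (f (line s)) = V}"
    using closed off_zero by (intro closure_minimal) auto
  then have "snd (f (line 0)) = V"
    by (auto simp: closure_complement)
  then show ?thesis by (simp add: line_def W_def V_def)
qed

lemma no_continuous_map_Tjur_to_transpose: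
  assumes t: "2 \<le> t" "t \<le> CARD('m::finite)" "t \<le> CARD('n::finite)"
  shows "\<not> continuous_map_of_transformations
      (Tjur t :: ((complex^'n^'m) \<times> (complex^'n) set) topology) fst
      (Tjur_transpose t :: ((complex^'n^'m) \<times> (complex^'m) set) topology) fst f"
proof
  assume f: "continuous_map_of_transformations
      (Tjur t :: ((complex^'n^'m) \<times> (complex^'n) set) topology) fst
      (Tjur_transpose t :: ((complex^'n^'m) \<times> (complex^'m) set) topology) fst f"
  obtain S :: "'n set" where S: "card S = t - 1"
    using t obtain_subset_with_card_n[of "t - 1" UNIV] by (metis diff_le_self le_trans)
  obtain R :: "'m set" where R: "card R = t - 1"
    using t obtain_subset_with_card_n[of "t - 1" UNIV] by (metis diff_le_self le_trans)
  have "R \<noteq> {}" "R \<noteq> UNIV" using R t by auto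
  then obtain a b where ab: "a \<in> R" "b \<notin> R" by auto
  define R' where "R' = insert b (R - {a})"
  have R': "card R' = t - 1" using R ab t by (simp add: R'_def card_Diff_singleton)
  have "coordinate_subspace (- R) = coordinate_subspace (- R')"
    using image_of_zero_matrix[OF f _ t(2,3) S R] image_of_zero_matrix[OF f _ t(2,3) S R'] t(1)
    by simp
  then have "R = R'" using inj_coordinate_subspace by blast
  then show False using ab by (auto simp: R'_def)
qed

lemma continuous_on_transpose:
  "continuous_on UNIV (transpose :: complex^'n^'m \<Rightarrow> complex^'m^'n)"
  unfolding transpose_def by (auto intro!: continuous_intros)

lemma continuous_map_Tjur_swap:
  "continuous_map (Tjur t :: ((complex^'n^'m) \<times> (complex^'n) set) topology)
     (Tjur_transpose t) (\<lambda>(A, W). (transpose A, W))"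
  unfolding Tjur_def Tjur_transpose_def
  by (intro continuous_map_into_subtopology continuous_map_from_subtopology)
    (auto simp: continuous_map_prod_top[where g = "\<lambda>W. W"] continuous_on_transpose)

lemma continuous_map_Tjur_transpose_swap:
  "continuous_map (Tjur_transpose t :: ((complex^'n^'m) \<times> (complex^'m) set) topology)
     (Tjur t) (\<lambda>(A, W). (transpose A, W))"
  unfolding Tjur_def Tjur_transpose_def
  by (intro continuous_map_into_subtopology continuous_map_from_subtopology)
    (auto simp: continuous_map_prod_top[where g = "\<lambda>W. W"] continuous_on_transpose)

text \<open>Conjugation with the homeomorphisms \<open>(A, W) \<mapsto> (A\<^sup>T, W)\<close> reverses the direction of a map of
  transformations.\<close>

lemma continuous_map_of_transformations_swap:
  assumes "continuous_map_of_transformations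
      (Tjur_transpose t :: ((complex^'n^'m) \<times> (complex^'m) set) topology) fst
      (Tjur t :: ((complex^'n^'m) \<times> (complex^'n) set) topology) fst f"
  shows "continuous_map_of_transformations
      (Tjur t :: ((complex^'m^'n) \<times> (complex^'m) set) topology) fst
      (Tjur_transpose t :: ((complex^'m^'n) \<times> (complex^'n) set) topology) fst
      ((\<lambda>(A, W). (transpose A, W)) \<circ> (f \<circ> (\<lambda>(A, W). (transpose A, W))))"
  unfolding continuous_map_of_transformations_def
proof
  show "continuous_map (Tjur t) (Tjur_transpose t)
      ((\<lambda>(A, W). (transpose A, W)) \<circ> (f \<circ> (\<lambda>(A, W). (transpose A, W))))"
    using assms unfolding continuous_map_of_transformations_def
    by (blast intro: continuous_map_compose continuous_map_Tjur_swap)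
  have "fst (f (transpose A, W)) = transpose A"
    if "(A, W) \<in> topspace (Tjur t)" for A :: "complex^'m^'n" and W
  proof -
    have "(transpose A, W) \<in> topspace (Tjur_transpose t)"
      using that by (auto simp: topspace_Tjur topspace_Tjur_transpose)
    then show ?thesis
      using assms by (auto simp: continuous_map_of_transformations_def)
  qed
  then show "\<forall>p\<in>topspace (Tjur t).
      fst p = fst (((\<lambda>(A, W). (transpose A, W)) \<circ> (f \<circ> (\<lambda>(A, W). (transpose A, W)))) p)"
    by (auto simp: split_beta)
qed

theorem proposition3p3:
  fixes t :: nat
  assumes "2 \<le> t" "t \<le> CARD('m::finite)" "t \<le> CARD('n::finite)"
  shows "\<not> (\<exists>f. continuous_map_of_transformations
             (Tjur t :: ((complex^'n^'m) \<times> (complex^'n) set) topology) fst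
             (Tjur_transpose t :: ((complex^'n^'m) \<times> (complex^'m) set) topology) fst f) \<and>
         \<not> (\<exists>f. continuous_map_of_transformations
             (Tjur_transpose t :: ((complex^'n^'m) \<times> (complex^'m) set) topology) fst
             (Tjur t :: ((complex^'n^'m) \<times> (complex^'n) set) topology) fst f)"
  using no_continuous_map_Tjur_to_transpose[OF assms(1,2,3)]
    no_continuous_map_Tjur_to_transpose[OF assms(1,3,2)]
    continuous_map_of_transformations_swap
  by blast

end
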